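(* There exist nonnegative integer constants $\gamma_{p;\mathbf a}$, indexed by integers $p\ge 1$ and vectors $\mathbf a$, and not depending on $f$, with $\gamma_{p;\mathbf a}\neq 0$ only if $\mathbf a\in\Lambda_p$, such that the following hold. (i) For every positive integer $p$ and every formal power series $f$, $$(fD)^p=\sum_{\mathbf a\in\Lambda_p}\gamma_{p;\mathbf a}\,f^{\mathbf a+\mathbf e_0}\,D^{\,p-\mathbf a\cdot\mathbf n^{\top}}.$$ (ii) For every $p\ge 2$ and every $\mathbf a\in\mathbb N^{\infty}$, $$\gamma_{p;\mathbf a}=\gamma_{p-1;\mathbf a-\mathbf e_0}+\sum_{i=0}^{p-2}(\mathbf a(i)+1)\,\gamma_{p-1;\mathbf a-\mathbf e_0+\mathbf e_i-\mathbf e_{i+1}},$$ where the terms $\gamma_{p-1;\mathbf b}$ on the right are $0$ by definition whenever $\mathbf b\notin\Lambda_{p-1}$ (in particular whenever $\mathbf b$ has a negative entry). (iii) For every positive integer $p$: if $\mathbf a(p-1)=1$ and $\gamma_{p;\mathbf a}\ne 0$, then $\mathbf a=(p-2)\mathbf e_0+\mathbf e_{p-1}$; moreover $\gamma_{p;(p-2)\mathbf e_0+\mathbf e_{p-1}}=1$. Furthermore, if $p\ge2$ and $\mathbf a(p-1)=0$, then the upper limit of the summation in the recurrence of (ii) may be replaced by $p-3$.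
   Context: $D=\frac{d}{dx}$ is the derivative operator; $f$ denotes a formal power series in $x$ over a field of characteristic $0$, and $fD$ is the operator $h\mapsto f\cdot D h$. $(fD)^p$ is the $p$-fold composition. $\mathbb N=\{0,1,2,\dots\}$; $\mathbb N^{\infty}$ is the set of infinite row vectors $\mathbf a=(\mathbf a(0),\mathbf a(1),\dots)$ of nonnegative integers. $\mathbf e_m(i)=\delta_{m,i}$, $\mathbf j(i)=1$, $\mathbf n(i)=i$ for all $i\ge0$, so $\mathbf a\cdot\mathbf j^\top=\sum_i\mathbf a(i)$ and $\mathbf a\cdot\mathbf n^\top=\sum_i i\,\mathbf a(i)$. For $\mathbf a$ with finitely many nonzero entries, $f^{\mathbf a}=\prod_i (f^{(i)})^{\mathbf a(i)}$ where $f^{(0)}=f$ and $f^{(i)}=D^if$. For $p\ge1$, $\Lambda_p=\{\mathbf a\in\mathbb N^{\infty}:\ \mathbf a\cdot\mathbf j^{\top}=p-1,\ \mathbf a\cdot\mathbf n^{\top}<p\}$. Any empty sum is $0$. *)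

theory Defs
  imports
    "HOL-Computational_Algebra.Formal_Power_Series"
    "HOL-Library.Function_Algebras"
begin

(* Index vectors have integer entries, so that vectors such as
   a - e_0 + e_i - e_(i+1), which may have negative entries, are formed without
   truncation; + and - are pointwise (Function_Algebras). The genuine index
   vectors are the elements of nat_vecs. *)

type_synonym vec = "nat \<Rightarrow> int"

definition nat_vecs :: "vec set" where
  "nat_vecs = {a. \<forall>i. 0 \<le> a i}"

definition unit_vec :: "nat \<Rightarrow> vec" where
  "unit_vec m = (\<lambda>i. if i = m then 1 else 0)"

definition ones_vec :: vec where
  "ones_vec = (\<lambda>i. 1)"

definition index_vec :: vec where
  "index_vec = (\<lambda>i. int i)"

(* Intended for finitely supported a only; otherwise the sum is the junk value 0. *)
definition dot :: "vec \<Rightarrow> vec \<Rightarrow> int" where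
  "dot a b = (\<Sum>i | a i \<noteq> 0. a i * b i)"

(* Finite support is implicit in the informal condition that the entries sum to
   p - 1; it has to be demanded here because of the junk value of dot. *)
definition Lambda :: "nat \<Rightarrow> vec set" where
  "Lambda p = {a \<in> nat_vecs. finite {i. a i \<noteq> 0} \<and>
                 dot a ones_vec = int p - 1 \<and> dot a index_vec < int p}"

(* Intended for finitely supported a in nat_vecs. *)
definition deriv_monom :: "'a::comm_ring_1 fps \<Rightarrow> vec \<Rightarrow> 'a fps" where
  "deriv_monom f a = (\<Prod>i | a i \<noteq> 0. (fps_nth_deriv i f) ^ nat (a i))"

(* Sums over Lambda p are genuine finite sums. *)
lemma finite_Lambda: "finite (Lambda p)"
proof -
  have "Lambda p \<subseteq> {a. \<forall>i. (i \<in> {..<p} \<longrightarrow> a i \<in> {0..int p}) \<and> (i \<notin> {..<p} \<longrightarrow> a i = 0)}"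
  proof clarsimp
    fix a i
    assume a: "a \<in> Lambda p"
    then have nn: "\<And>j. 0 \<le> a j" and fin: "finite {j. a j \<noteq> 0}"
      and d1: "dot a ones_vec = int p - 1" and d2: "dot a index_vec < int p"
      by (auto simp: Lambda_def nat_vecs_def)
    have "a i \<le> dot a ones_vec" if "a i \<noteq> 0"
      using member_le_sum[of i "{j. a j \<noteq> 0}" a] that nn fin
      by (auto simp: dot_def ones_vec_def)
    moreover have "a i * int i \<le> dot a index_vec" if "a i \<noteq> 0"
      using member_le_sum[of i "{j. a j \<noteq> 0}" "\<lambda>j. a j * int j"] that nn fin
      by (auto simp: dot_def index_vec_def)
    moreover have "int i \<le> a i * int i" if "a i \<noteq> 0"
      using nn[of i] that mult_right_mono[of 1 "a i" "int i"] by simp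
    ultimately show "(i < p \<longrightarrow> 0 \<le> a i \<and> a i \<le> int p) \<and> (\<not> i < p \<longrightarrow> a i = 0)"
      using nn[of i] d1 d2 by (cases "a i = 0") force+
  qed
  then show ?thesis
    by (rule finite_subset) (rule finite_set_of_finite_funs; simp)
qed

end

theory Submission
  imports Defs
begin

text \<open>
  Applying \<open>fD\<close> to \<open>f\<^sup>b\<^sup>+\<^sup>e D\<^sup>k\<close> with \<open>e = e\<^sub>0\<close> either raises the order of the operator, giving the
  index vector \<open>b + e\<^sub>0\<close>, or differentiates one of the \<open>b(i) + \<delta>\<^sub>i\<^sub>0\<close> factors \<open>f\<^sup>(\<^sup>i\<^sup>)\<close>, giving
  \<open>a = b + e\<^sub>0 - e\<^sub>i + e\<^sub>i\<^sub>+\<^sub>1\<close>; the multiplicity \<open>b(i) + \<delta>\<^sub>i\<^sub>0\<close> is then \<open>a(i) + 1\<close>. Collecting terms by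
  \<open>a\<close> yields the recurrence, which is therefore taken as the definition of the coefficients.
\<close>

subsection \<open>Finitely supported vectors\<close>

lemma finite_support_unit_vec: "finite {i. unit_vec m i \<noteq> 0}"
  by (simp add: unit_vec_def)

lemma finite_support_add:
  fixes a b :: vec
  assumes "finite {i. a i \<noteq> 0}" "finite {i. b i \<noteq> 0}"
  shows "finite {i. (a + b) i \<noteq> 0}"
  by (rule finite_subset[OF _ finite_UnI[OF assms]]) auto

lemma finite_support_diff:
  fixes a b :: vec
  assumes "finite {i. a i \<noteq> 0}" "finite {i. b i \<noteq> 0}"
  shows "finite {i. (a - b) i \<noteq> 0}"
  by (rule finite_subset[OF _ finite_UnI[OF assms]]) auto

lemmas finite_support = finite_support_unit_vec finite_support_add finite_support_diff

lemma dot_superset: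
  assumes "finite S" "{i. a i \<noteq> 0} \<subseteq> S"
  shows "dot a w = (\<Sum>i\<in>S. a i * w i)"
  unfolding dot_def using assms by (intro sum.mono_neutral_left) auto

lemma dot_add:
  assumes "finite {i. a i \<noteq> 0}" "finite {i. b i \<noteq> 0}"
  shows "dot (a + b) w = dot a w + dot b w"
proof -
  let ?S = "{i. a i \<noteq> 0} \<union> {i. b i \<noteq> 0}"
  have S: "finite ?S" using assms by simp
  have "dot (a + b) w = (\<Sum>i\<in>?S. (a + b) i * w i)"
    by (rule dot_superset[OF S]) auto
  also have "\<dots> = (\<Sum>i\<in>?S. a i * w i) + (\<Sum>i\<in>?S. b i * w i)"
    by (simp add: distrib_right sum.distrib)
  also have "\<dots> = dot a w + dot b w"
    using dot_superset[OF S, of a w] dot_superset[OF S, of b w] by auto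
  finally show ?thesis .
qed

lemma dot_diff:
  assumes "finite {i. a i \<noteq> 0}" "finite {i. b i \<noteq> 0}"
  shows "dot (a - b) w = dot a w - dot b w"
  using dot_add[of "a - b" b w] finite_support_diff[OF assms] assms(2) by simp

lemma dot_unit_vec: "dot (unit_vec m) w = w m"
  using dot_superset[of "{m}" "unit_vec m" w] by (auto simp: unit_vec_def)

lemmas dot_simps = dot_add dot_diff dot_unit_vec finite_support

section \<open>Membership in \<open>Lambda p\<close> and the two passages from
  \<open>Lambda p\<close> to \<open>Lambda (Suc p)\<close>\<close>

lemma Lambda_I:
  assumes "a \<in> nat_vecs" "finite {i. a i \<noteq> 0}"
    "dot a ones_vec = int p - 1" "dot a index_vec < int p"
  shows "a \<in> Lambda p"
  using assms by (simp add: Lambda_def)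

lemma Lambda_D:
  assumes "a \<in> Lambda p"
  shows "a \<in> nat_vecs" "0 \<le> a i" "finite {i. a i \<noteq> 0}"
    "dot a ones_vec = int p - 1" "dot a index_vec < int p"
  using assms by (auto simp: Lambda_def nat_vecs_def)

text \<open>A nonzero entry at index \<open>i\<close> is at least 1, so it alone contributes at
  least \<open>i\<close> to the weighted sum, which is below \<open>p\<close>.\<close>

lemma Lambda_eq_0:
  assumes "a \<in> Lambda p" "p \<le> i"
  shows "a i = 0"
proof (rule ccontr)
  assume "a i \<noteq> 0"
  then have "1 \<le> a i" using Lambda_D(2)[OF assms(1), of i] by linarith
  then have "int i \<le> a i * int i" using mult_right_mono[of 1 "a i" "int i"] by simp
  also have "\<dots> \<le> dot a index_vec"
    using member_le_sum[of i "{j. a j \<noteq> 0}" "\<lambda>j. a j * int j"] \<open>a i \<noteq> 0\<close> Lambda_D[OF assms(1)]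
    by (auto simp: dot_def index_vec_def)
  finally show False using Lambda_D(5)[OF assms(1)] assms(2) by linarith
qed

lemma Lambda_1: "Lambda (Suc 0) = {0}"
proof (intro equalityI subsetI)
  fix a assume a: "a \<in> Lambda (Suc 0)"
  then have "a i = 0" if "i \<noteq> 0" for i
    using Lambda_eq_0[OF a, of i] that by auto
  moreover from this have "dot a ones_vec = a 0"
    using dot_superset[of "{0}" a ones_vec] by (auto simp: ones_vec_def)
  ultimately have "a i = 0" for i
    using Lambda_D(4)[OF a] by (cases "i = 0") auto
  then show "a \<in> {0}" by auto
qed (auto simp: Lambda_def nat_vecs_def dot_def)

lemma Lambda_Suc_add_unit:
  assumes "a \<in> Lambda p"
  shows "a + unit_vec 0 \<in> Lambda (Suc p)"
  using Lambda_D[OF assms]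
  by (intro Lambda_I)
     (simp_all add: dot_simps ones_vec_def index_vec_def del: plus_fun_apply,
      simp add: nat_vecs_def unit_vec_def)

lemma dot_shift_index:
  assumes "finite {i. a i \<noteq> 0}"
  shows "dot (a + unit_vec 0 - unit_vec i + unit_vec (Suc i)) index_vec = dot a index_vec + 1"
  using assms by (simp add: dot_simps index_vec_def del: plus_fun_apply minus_apply)

text \<open>The passage in which D hits a factor of the monomial: the entry sum and the weighted sum
  both grow by one, as do their bounds. The second hypothesis says that a factor of order
  \<open>i\<close> is there to be differentiated, so subtracting \<open>unit_vec i\<close> leaves no
  negative entry.\<close>

lemma Lambda_Suc_shift:
  assumes "a \<in> Lambda p" "(a + unit_vec 0) i \<noteq> 0"
  shows "a + unit_vec 0 - unit_vec i + unit_vec (Suc i) \<in> Lambda (Suc p)"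
proof (rule Lambda_I)
  have "(a + unit_vec 0) i \<ge> 1"
    using assms(2) Lambda_D(2)[OF assms(1), of i] by (auto simp: unit_vec_def split: if_splits)
  then show "a + unit_vec 0 - unit_vec i + unit_vec (Suc i) \<in> nat_vecs"
    using Lambda_D(2)[OF assms(1)] by (auto simp: nat_vecs_def unit_vec_def)
qed (use Lambda_D[OF assms(1)] in
  \<open>simp_all add: dot_simps ones_vec_def index_vec_def del: plus_fun_apply minus_apply\<close>)

subsection \<open>Monomials in the derivatives\<close>

lemma deriv_monom_superset:
  assumes "finite S" "{i. a i \<noteq> 0} \<subseteq> S"
  shows "deriv_monom f a = (\<Prod>i\<in>S. fps_nth_deriv i f ^ nat (a i))"
  unfolding deriv_monom_def using assms by (intro prod.mono_neutral_left) auto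

lemma deriv_monom_add_unit:
  assumes "a \<in> nat_vecs" "finite {i. a i \<noteq> 0}"
  shows "deriv_monom f (a + unit_vec m) = fps_nth_deriv m f * deriv_monom f a"
proof -
  let ?S = "insert m {i. a i \<noteq> 0}"
  let ?T = "{i. a i \<noteq> 0} - {m}"
  have S: "finite ?S" and T: "finite ?T" "m \<notin> ?T" "insert m ?T = ?S" using assms(2) by auto
  have "deriv_monom f (a + unit_vec m) = (\<Prod>i\<in>?S. fps_nth_deriv i f ^ nat ((a + unit_vec m) i))"
    by (rule deriv_monom_superset[OF S]) (auto simp: unit_vec_def)
  also have "\<dots> = fps_nth_deriv m f ^ Suc (nat (a m)) * (\<Prod>i\<in>?T. fps_nth_deriv i f ^ nat (a i))"
    unfolding T(3)[symmetric] prod.insert[OF T(1,2)]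
    using assms(1) by (intro arg_cong2[of _ _ _ _ "(*)"] prod.cong)
      (auto simp: unit_vec_def nat_vecs_def nat_add_distrib)
  also have "\<dots> = fps_nth_deriv m f * (\<Prod>i\<in>?S. fps_nth_deriv i f ^ nat (a i))"
    unfolding T(3)[symmetric] prod.insert[OF T(1,2)] by (simp add: mult.assoc)
  also have "(\<Prod>i\<in>?S. fps_nth_deriv i f ^ nat (a i)) = deriv_monom f a"
    by (rule deriv_monom_superset[OF S, symmetric]) auto
  finally show ?thesis .
qed

lemma fps_deriv_prod:
  fixes g :: "'b \<Rightarrow> 'a::comm_ring_1 fps"
  assumes "finite S"
  shows "fps_deriv (\<Prod>i\<in>S. g i) = (\<Sum>i\<in>S. fps_deriv (g i) * (\<Prod>j\<in>S - {i}. g j))"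
  using assms
proof (induction S rule: finite_induct)
  case (insert x S)
  have "(\<Prod>j\<in>insert x S - {i}. g j) = g x * (\<Prod>j\<in>S - {i}. g j)" if "i \<in> S" for i
    using insert that by (subst insert_Diff_if) auto
  then show ?case
    using insert by (simp add: sum_distrib_left algebra_simps cong: sum.cong)
qed simp

text \<open>The Leibniz rule: each of the \<open>a i\<close> factors of order \<open>i\<close> is in
  turn replaced by one of order \<open>Suc i\<close>. Where \<open>a i = 0\<close>, the vector on
  the right is not genuine, but its multiplicity is 0.\<close>

lemma fps_deriv_deriv_monom:
  fixes f :: "'a::comm_ring_1 fps"
  assumes a: "a \<in> nat_vecs" and supp: "{i. a i \<noteq> 0} \<subseteq> {..<n}"
  shows "fps_deriv (deriv_monom f a) =
    (\<Sum>i<n. of_nat (nat (a i)) * deriv_monom f (a - unit_vec i + unit_vec (Suc i)))"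
proof -
  let ?g = "\<lambda>i. fps_nth_deriv i f ^ nat (a i)"
  have "fps_deriv (?g i) * (\<Prod>j\<in>{..<n} - {i}. ?g j) =
      of_nat (nat (a i)) * deriv_monom f (a - unit_vec i + unit_vec (Suc i))" if "i < n" for i
  proof (cases "a i = 0")
    case False
    \<comment> \<open>Removing one factor first and then multiplying by the derivative of order
      \<open>Suc i\<close> also covers \<open>Suc i = n\<close>, where the new vector is no longer
      supported in \<open>{..<n}\<close>.\<close>
    define c where "c = a - unit_vec i"
    have c: "c \<in> nat_vecs" and sc: "{j. c j \<noteq> 0} \<subseteq> {..<n}"
    proof -
      have "1 \<le> a i" using a False by (simp add: nat_vecs_def order_less_le int_one_le_iff_zero_less)
      then show "c \<in> nat_vecs" using a by (simp add: c_def nat_vecs_def unit_vec_def)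
      show "{j. c j \<noteq> 0} \<subseteq> {..<n}" using supp that by (auto simp: c_def unit_vec_def split: if_splits)
    qed
    have "deriv_monom f c = (\<Prod>j<n. fps_nth_deriv j f ^ nat (c j))"
      by (rule deriv_monom_superset[OF _ sc]) simp
    also have "\<dots> = fps_nth_deriv i f ^ nat (c i) * (\<Prod>j\<in>{..<n} - {i}. fps_nth_deriv j f ^ nat (c j))"
      using that by (subst prod.remove[of _ i]) auto
    also have "(\<Prod>j\<in>{..<n} - {i}. fps_nth_deriv j f ^ nat (c j)) = (\<Prod>j\<in>{..<n} - {i}. ?g j)"
      by (intro prod.cong) (auto simp: c_def unit_vec_def)
    also have "nat (c i) = nat (a i) - 1"
      by (simp add: c_def unit_vec_def nat_diff_distrib')
    finally have "deriv_monom f c =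
      fps_nth_deriv i f ^ (nat (a i) - 1) * (\<Prod>j\<in>{..<n} - {i}. ?g j)" .
    moreover have "deriv_monom f (c + unit_vec (Suc i)) = fps_nth_deriv (Suc i) f * deriv_monom f c"
      using c sc by (intro deriv_monom_add_unit) (auto intro: finite_subset)
    ultimately show ?thesis
      by (simp add: c_def[symmetric] fps_deriv_power fps_nth_deriv_commute[symmetric] mult_ac
            fps_of_nat del: plus_fun_apply minus_apply)
  qed simp
  moreover have "deriv_monom f a = (\<Prod>i<n. ?g i)"
    by (rule deriv_monom_superset[OF _ supp]) simp
  ultimately show ?thesis
    by (simp add: fps_deriv_prod)
qed

subsection \<open>The coefficients\<close>

text \<open>
  The start at \<open>p = 0\<close>, supported at the non-genuine vector \<open>-e\<^sub>0\<close>, encodes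
  \<open>(fD)\<^sup>0 = 1\<close> and makes the recurrence produce \<open>fD\<close> for \<open>p = 1\<close>.
\<close>

primrec gam :: "nat \<Rightarrow> vec \<Rightarrow> nat" where
  "gam 0 a = (if a = - unit_vec 0 then 1 else 0)"
| "gam (Suc p) a = gam p (a - unit_vec 0) +
    (\<Sum>i<p. nat (a i + 1) * gam p (a - unit_vec 0 + unit_vec i - unit_vec (Suc i)))"

lemma gam_1: "gam (Suc 0) a = (if a = 0 then 1 else 0)"
  by (simp add: diff_eq_eq)

text \<open>A nonzero value has a nonzero summand in the recurrence. Its argument lies in
  \<open>Lambda p\<close> by induction, and \<open>a\<close> arises from it by one of the two
  passages. The induction starts at 1 because the vector supporting \<open>gam 0\<close> has a
  negative entry.\<close>

lemma gam_support:
  assumes "1 \<le> p" "gam p a \<noteq> 0"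
  shows "a \<in> Lambda p"
  using assms
proof (induction p arbitrary: a rule: dec_induct)
  case base
  then show ?case by (simp add: gam_1 Lambda_1 del: gam.simps split: if_splits)
next
  case (step p)
  consider "gam p (a - unit_vec 0) \<noteq> 0"
    | i where "i < p" "a i + 1 > 0" "gam p (a - unit_vec 0 + unit_vec i - unit_vec (Suc i)) \<noteq> 0"
  proof (rule ccontr)
    note c1 = that(1) and c2 = that(2)
    assume not: "\<not> thesis"
    have "nat (a i + 1) * gam p (a - unit_vec 0 + unit_vec i - unit_vec (Suc i)) = 0"
      if "i < p" for i
      using not c2 that
      by (cases "0 < a i + 1") auto
    moreover have "gam p (a - unit_vec 0) = 0" using not c1 by blast
    ultimately show False using step.prems by simp
  qed
  then show ?case
  proof cases
    case 1
    then show ?thesis using Lambda_Suc_add_unit[OF step.IH[OF 1]] by (simp del: plus_fun_apply minus_apply)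
  next
    case 2
    let ?b = "a - unit_vec 0 + unit_vec i - unit_vec (Suc i)"
    have b: "?b \<in> Lambda p" using step.IH 2 by blast
    \<comment> \<open>This entry equals \<open>a i + 1\<close>, which is positive because the
      summand is nonzero.\<close>
    moreover have "(?b + unit_vec 0) i \<noteq> 0" using 2 by (simp add: unit_vec_def)
    ultimately have "?b + unit_vec 0 - unit_vec i + unit_vec (Suc i) \<in> Lambda (Suc p)"
      by (rule Lambda_Suc_shift)
    then show ?thesis by (simp del: plus_fun_apply minus_apply)
  qed
qed

lemma gam_recurrence:
  assumes "a \<in> nat_vecs"
  shows "int (gam (Suc p) a) = int (gam p (a - unit_vec 0)) +
    (\<Sum>i<p. (a i + 1) * int (gam p (a - unit_vec 0 + unit_vec i - unit_vec (Suc i))))"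
  using assms by (simp add: nat_vecs_def)

text \<open>The entry 1 at index \<open>p - 1\<close> already uses up the largest weighted sum
  allowed, so all other entries at positive indices vanish; the entry sum then fixes
  \<open>a 0\<close>.\<close>

lemma Lambda_extremal_vector:
  assumes "a \<in> Lambda p" "1 \<le> p" "a (p - 1) = 1"
  shows "a = (\<lambda>i. (int p - 2) * unit_vec 0 i) + unit_vec (p - 1)"
proof -
  note D = Lambda_D[OF assms(1)]
  have p: "p \<noteq> 1"
    using assms Lambda_1 by auto
  have supp: "{i. a i \<noteq> 0} \<subseteq> {..<p}"
    using Lambda_eq_0[OF assms(1)] not_le by blast
  have zero: "a i = 0" if "i \<noteq> 0" "i \<noteq> p - 1" for i
  proof (rule ccontr)
    assume i: "a i \<noteq> 0"
    then have "i \<in> {..<p}" using supp by auto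
    then have "(\<Sum>j\<in>{i, p - 1}. a j * int j) \<le> dot a index_vec"
      unfolding dot_superset[OF finite_lessThan supp] index_vec_def
      using D(2) assms(2) by (intro sum_mono2) auto
    moreover have "0 < a i" using i D(2)[of i] by linarith
    then have "0 < a i * int i" using that(1) by simp
    ultimately show False using that(2) assms(2,3) D(5) by (simp add: of_nat_diff)
  qed
  have supp2: "{i. a i \<noteq> 0} \<subseteq> {0, p - 1}" using zero by blast
  have "(\<Sum>i\<in>{0, p - 1}. a i) = dot a ones_vec"
    using dot_superset[OF _ supp2, of ones_vec] by (simp add: ones_vec_def)
  then have "a 0 = int p - 2" using assms(2,3) p D(4) by simp
  then show ?thesis using zero assms(2,3) p by (auto simp: unit_vec_def fun_eq_iff)
qed

text \<open>Only the summand \<open>i = p - 1\<close> of the recurrence survives: every other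
  argument keeps the entry 1 at index \<open>p\<close>, where vectors of \<open>Lambda p\<close>
  vanish. Its factor is 1, and its argument is the extremal vector for \<open>p\<close>.\<close>

lemma gam_extremal_value:
  assumes "1 \<le> p"
  shows "gam p ((\<lambda>i. (int p - 2) * unit_vec 0 i) + unit_vec (p - 1)) = 1"
  using assms
proof (induction p rule: dec_induct)
  case base
  \<comment> \<open>For \<open>p = 1\<close> both unit vectors are at index 0, with coefficients -1
    and 1.\<close>
  have "(\<lambda>i. (int 1 - 2) * unit_vec 0 i) + unit_vec (1 - 1) = 0"
    by (auto simp: unit_vec_def)
  then show ?case unfolding One_nat_def gam_1 by simp
next
  case (step p)
  define a where "a = (\<lambda>i. (int (Suc p) - 2) * unit_vec 0 i) + unit_vec p"
  have vanish: "gam p b = 0" if "b p \<noteq> 0" for b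
    using gam_support[of p b] Lambda_eq_0[of b p p] that step.hyps by blast
  have shift: "a - unit_vec 0 + unit_vec (p - 1) - unit_vec p =
      (\<lambda>i. (int p - 2) * unit_vec 0 i) + unit_vec (p - 1)"
    using step.hyps by (auto simp: a_def fun_eq_iff algebra_simps)
  have "gam p (a - unit_vec 0) = 0"
    using step.hyps by (intro vanish) (auto simp: a_def unit_vec_def)
  moreover have "gam p (a - unit_vec 0 + unit_vec i - unit_vec (Suc i)) = 0" if "i \<in> {..<p} - {p - 1}" for i
    using step.hyps that by (intro vanish) (auto simp: a_def unit_vec_def)
  moreover have "a (p - 1) = 0"
    using step.hyps by (auto simp: a_def unit_vec_def)
  ultimately have "gam (Suc p) a = gam p (a - unit_vec 0 + unit_vec (p - 1) - unit_vec p)"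
    using step.hyps sum.remove[of "{..<p}" "p - 1" "\<lambda>i. nat (a i + 1) *
        gam p (a - unit_vec 0 + unit_vec i - unit_vec (Suc i))"]
    by (simp del: plus_fun_apply minus_apply)
  then have "gam (Suc p) a = 1" using step.IH unfolding shift by (simp only:)
  then show ?case unfolding a_def by (simp only: diff_Suc_1)
qed

subsection \<open>Expansion of the operator power\<close>

text \<open>One summand of the expansion without its coefficient, applied to \<open>h\<close>. For
  \<open>a\<close> in \<open>Lambda p\<close> the order of the derivative is positive, so
  \<open>nat\<close> truncates nothing.\<close>

definition op_term :: "'a::comm_ring_1 fps \<Rightarrow> nat \<Rightarrow> vec \<Rightarrow> 'a fps \<Rightarrow> 'a fps" where
  "op_term f p a h = deriv_monom f (a + unit_vec 0) * fps_nth_deriv (nat (int p - dot a index_vec)) h"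

lemma op_term_step:
  assumes a: "a \<in> Lambda p"
  shows "f * fps_deriv (op_term f p a h) = op_term f (Suc p) (a + unit_vec 0) h +
    (\<Sum>i<p. of_nat (nat ((a + unit_vec 0) i)) *
      op_term f (Suc p) (a + unit_vec 0 - unit_vec i + unit_vec (Suc i)) h)"
proof -
  note D = Lambda_D[OF a]
  define k where "k = nat (int p - dot a index_vec)"
  define b where "b = a + unit_vec 0"
  \<comment> \<open>The weighted sum is nonnegative and below \<open>p\<close>. Hence index 0, where
    \<open>b\<close> has a nonzero entry, lies in \<open>{..<p}\<close>.\<close>
  have p: "0 < p" using D(5) sum_nonneg[of "{j. a j \<noteq> 0}" "\<lambda>j. a j * int j"] D(2)
    by (cases p) (auto simp: dot_def index_vec_def)
  have b: "b \<in> nat_vecs" "finite {i. b i \<noteq> 0}"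
    using Lambda_D(1,3)[OF Lambda_Suc_add_unit[OF a]] by (simp_all add: b_def)
  have supp: "{i. b i \<noteq> 0} \<subseteq> {..<p}"
    using Lambda_eq_0[OF a] p
    by (force simp: b_def unit_vec_def not_less[symmetric] split: if_splits)
  have "op_term f (Suc p) b h = f * deriv_monom f b * fps_nth_deriv (Suc k) h"
  proof -
    have "nat (int (Suc p) - dot b index_vec) = Suc k"
      using D(3,5) by (simp add: b_def k_def dot_simps index_vec_def del: plus_fun_apply)
    then show ?thesis
      using deriv_monom_add_unit[OF b, of f 0] by (simp add: op_term_def)
  qed
  moreover have "of_nat (nat (b i)) * op_term f (Suc p) (b - unit_vec i + unit_vec (Suc i)) h =
      f * (of_nat (nat (b i)) * deriv_monom f (b - unit_vec i + unit_vec (Suc i))) *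
      fps_nth_deriv k h" for i
  proof (cases "b i = 0")
    case False
    let ?c = "b - unit_vec i + unit_vec (Suc i)"
    have "?c \<in> Lambda (Suc p)"
      using Lambda_Suc_shift[OF a] False by (simp add: b_def)
    note c = Lambda_D[OF this]
    \<comment> \<open>Both \<open>p\<close> and the weighted sum grow by one, so the order of the
      derivative of \<open>h\<close> stays the same.\<close>
    have "nat (int (Suc p) - dot ?c index_vec) = k"
      using dot_shift_index[OF D(3), of i] by (simp add: b_def k_def)
    then show ?thesis
      using deriv_monom_add_unit[of ?c f 0] c(1,3)
      by (simp add: op_term_def mult_ac del: plus_fun_apply minus_apply)
  qed simp
  moreover have "f * fps_deriv (op_term f p a h) =
      f * deriv_monom f b * fps_nth_deriv (Suc k) h +
      f * fps_deriv (deriv_monom f b) * fps_nth_deriv k h"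
    by (simp add: op_term_def b_def k_def fps_nth_deriv_commute[symmetric] algebra_simps)
  ultimately show ?thesis
    unfolding b_def[symmetric]
    by (simp add: fps_deriv_deriv_monom[OF b(1) supp] sum_distrib_left sum_distrib_right)
qed

lemma fps_deriv_sum:
  fixes g :: "'b \<Rightarrow> 'a::comm_ring_1 fps"
  shows "fps_deriv (\<Sum>i\<in>S. g i) = (\<Sum>i\<in>S. fps_deriv (g i))"
  by (induction S rule: infinite_finite_induct) auto

lemma op_power_expansion:
  fixes f h :: "'a::comm_ring_1 fps"
  assumes "1 \<le> p"
  shows "((\<lambda>h. f * fps_deriv h) ^^ p) h = (\<Sum>a\<in>Lambda p. of_nat (gam p a) * op_term f p a h)"
  using assms
proof (induction p rule: dec_induct)
  case base
  have "deriv_monom f (unit_vec 0) = f"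
    using deriv_monom_superset[of "{0}" "unit_vec 0" f] by (auto simp: unit_vec_def)
  moreover have "dot 0 index_vec = 0" by (simp add: dot_def)
  ultimately show ?case
    unfolding One_nat_def Lambda_1 by (simp add: gam_1 op_term_def del: gam.simps zero_fun_apply)
next
  case (step p)
  let ?g = "\<lambda>a. of_nat (gam p a) :: 'a fps"
  let ?T = "\<lambda>a. op_term f (Suc p) a h"
  let ?s = "\<lambda>i a. a + unit_vec 0 - unit_vec i + unit_vec (Suc i)"
  let ?t = "\<lambda>i a. a - unit_vec 0 + unit_vec i - unit_vec (Suc i)"
  have g0: "?g a = 0" if "a \<notin> Lambda p" for a
    using gam_support[of p a] that step.hyps by force
  have "((\<lambda>h. f * fps_deriv h) ^^ Suc p) h = (\<Sum>a\<in>Lambda p. ?g a * (f * fps_deriv (op_term f p a h)))"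
    by (simp add: step.IH fps_deriv_sum sum_distrib_left mult_ac)
  also have "\<dots> = (\<Sum>a\<in>Lambda p. ?g a * ?T (a + unit_vec 0)) +
      (\<Sum>a\<in>Lambda p. \<Sum>i<p. ?g a * of_nat (nat ((a + unit_vec 0) i)) * ?T (?s i a))"
    by (simp add: op_term_step distrib_left sum.distrib sum_distrib_left mult.assoc
          del: plus_fun_apply)
  also have "(\<Sum>a\<in>Lambda p. ?g a * ?T (a + unit_vec 0)) =
      (\<Sum>a\<in>Lambda (Suc p). ?g (a - unit_vec 0) * ?T a)"
    \<comment> \<open>Vectors of \<open>Lambda (Suc p)\<close> that do not come from
      \<open>Lambda p\<close> by adding \<open>unit_vec 0\<close> contribute 0, since
      \<open>gam p\<close> vanishes outside \<open>Lambda p\<close>.\<close>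
    by (rule sum.reindex_bij_witness_not_neutral
        [where S' = "{}" and T' = "{a \<in> Lambda (Suc p). a - unit_vec 0 \<notin> Lambda p}"
           and i = "\<lambda>a. a - unit_vec 0" and j = "\<lambda>a. a + unit_vec 0"])
       (auto simp: finite_Lambda g0 Lambda_Suc_add_unit)
  also have "(\<Sum>a\<in>Lambda p. \<Sum>i<p. ?g a * of_nat (nat ((a + unit_vec 0) i)) * ?T (?s i a)) =
      (\<Sum>i<p. \<Sum>a\<in>Lambda p. ?g a * of_nat (nat ((a + unit_vec 0) i)) * ?T (?s i a))"
    by (rule sum.swap)
  also have "\<dots> = (\<Sum>i<p. \<Sum>a\<in>Lambda (Suc p). ?g (?t i a) * of_nat (nat (a i + 1)) * ?T a)"
  proof (rule sum.cong[OF refl])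
    fix i
    have inv: "?t i (?s i a) = a" "?s i (?t i a) = a" for a by simp_all
    have coeff: "?s i a i + 1 = (a + unit_vec 0) i" "(?t i a + unit_vec 0) i = a i + 1" for a
      by (simp_all add: unit_vec_def)
    show "(\<Sum>a\<in>Lambda p. ?g a * of_nat (nat ((a + unit_vec 0) i)) * ?T (?s i a)) =
      (\<Sum>a\<in>Lambda (Suc p). ?g (?t i a) * of_nat (nat (a i + 1)) * ?T a)"
    \<comment> \<open>For fixed \<open>i\<close>, \<open>?s i\<close> and \<open>?t i\<close> are
      mutually inverse. The terms left unmatched vanish: on the left the multiplicity is 0, on the
      right \<open>gam p\<close> is taken outside \<open>Lambda p\<close>.\<close>
    proof (rule sum.reindex_bij_witness_not_neutral
        [where S' = "{a \<in> Lambda p. (a + unit_vec 0) i = 0}"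
           and T' = "{a \<in> Lambda (Suc p). ?t i a \<notin> Lambda p}"
           and i = "?t i" and j = "?s i"])
      fix a assume "a \<in> Lambda (Suc p) - {a \<in> Lambda (Suc p). ?t i a \<notin> Lambda p}"
      then have a: "a \<in> Lambda (Suc p)" "?t i a \<in> Lambda p" by auto
      show "?s i (?t i a) = a" by (rule inv)
      have "(?t i a + unit_vec 0) i \<noteq> 0"
        using Lambda_D(2)[OF a(1), of i] unfolding coeff by linarith
      then show "?t i a \<in> Lambda p - {a \<in> Lambda p. (a + unit_vec 0) i = 0}"
        using a(2) by blast
    next
      fix a assume "a \<in> Lambda p - {a \<in> Lambda p. (a + unit_vec 0) i = 0}"
      then have a: "a \<in> Lambda p" "(a + unit_vec 0) i \<noteq> 0" by auto
      show "?t i (?s i a) = a" by (rule inv)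
      show "?s i a \<in> Lambda (Suc p) - {a \<in> Lambda (Suc p). ?t i a \<notin> Lambda p}"
        using Lambda_Suc_shift[OF a] a(1) inv(1)[of a] by auto
    next
      fix a
      show "?g (?t i (?s i a)) * of_nat (nat (?s i a i + 1)) * ?T (?s i a) =
          ?g a * of_nat (nat ((a + unit_vec 0) i)) * ?T (?s i a)"
        unfolding inv coeff ..
    qed (auto simp: finite_Lambda g0 simp del: plus_fun_apply)
  qed
  also have "\<dots> = (\<Sum>a\<in>Lambda (Suc p). \<Sum>i<p. ?g (?t i a) * of_nat (nat (a i + 1)) * ?T a)"
    by (rule sum.swap)
  also have "(\<Sum>a\<in>Lambda (Suc p). ?g (a - unit_vec 0) * ?T a) + \<dots> =
      (\<Sum>a\<in>Lambda (Suc p). of_nat (gam (Suc p) a) * ?T a)"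
    unfolding sum.distrib[symmetric]
    by (rule sum.cong) (simp_all add: distrib_right distrib_left sum_distrib_left mult_ac)
  finally show ?case .
qed

theorem theorem1:
  shows "\<exists>\<gamma> :: nat \<Rightarrow> vec \<Rightarrow> nat.
    (\<forall>p a. 1 \<le> p \<longrightarrow> \<gamma> p a \<noteq> 0 \<longrightarrow> a \<in> Lambda p) \<and>
    (\<forall>p. \<forall>f :: 'a::field_char_0 fps. 1 \<le> p \<longrightarrow>
       (\<lambda>h. f * fps_deriv h) ^^ p =
       (\<lambda>h. \<Sum>a\<in>Lambda p. of_nat (\<gamma> p a) * deriv_monom f (a + unit_vec 0)
                * fps_nth_deriv (nat (int p - dot a index_vec)) h)) \<and>
    (\<forall>p. \<forall>a\<in>nat_vecs. 2 \<le> p \<longrightarrow>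
       int (\<gamma> p a) = int (\<gamma> (p - 1) (a - unit_vec 0)) +
         (\<Sum>i\<in>{0..p - 2}. (a i + 1) *
            int (\<gamma> (p - 1) (a - unit_vec 0 + unit_vec i - unit_vec (i + 1))))) \<and>
    (\<forall>p. 1 \<le> p \<longrightarrow>
       (\<forall>a\<in>nat_vecs. a (p - 1) = 1 \<longrightarrow> \<gamma> p a \<noteq> 0 \<longrightarrow>
          a = (\<lambda>i. (int p - 2) * unit_vec 0 i) + unit_vec (p - 1)) \<and>
       \<gamma> p ((\<lambda>i. (int p - 2) * unit_vec 0 i) + unit_vec (p - 1)) = 1) \<and>
    (\<forall>p. \<forall>a\<in>nat_vecs. 2 \<le> p \<longrightarrow> a (p - 1) = 0 \<longrightarrow>
       int (\<gamma> p a) = int (\<gamma> (p - 1) (a - unit_vec 0)) +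
         (\<Sum>i\<in>{0..<p - 2}. (a i + 1) *
            int (\<gamma> (p - 1) (a - unit_vec 0 + unit_vec i - unit_vec (i + 1)))))"
proof (rule exI[of _ gam], intro conjI allI ballI impI)
  fix p a assume "1 \<le> p" "gam p a \<noteq> 0"
  then show "a \<in> Lambda p" by (rule gam_support)
next
  fix p :: nat and f :: "'a fps" assume "1 \<le> p"
  then show "(\<lambda>h. f * fps_deriv h) ^^ p =
       (\<lambda>h. \<Sum>a\<in>Lambda p. of_nat (gam p a) * deriv_monom f (a + unit_vec 0)
                * fps_nth_deriv (nat (int p - dot a index_vec)) h)"
    by (simp add: fun_eq_iff op_power_expansion op_term_def mult.assoc)
next
  fix p :: nat and a assume a: "a \<in> nat_vecs" and p: "2 \<le> p"
  obtain q where q: "p = Suc (Suc q)" using le_Suc_ex[OF p] by auto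
  show rec: "int (gam p a) = int (gam (p - 1) (a - unit_vec 0)) +
         (\<Sum>i\<in>{0..p - 2}. (a i + 1) *
            int (gam (p - 1) (a - unit_vec 0 + unit_vec i - unit_vec (i + 1))))"
    using gam_recurrence[OF a, of "Suc q"]
    by (simp add: q atLeast0AtMost lessThan_Suc_atMost del: gam.simps)
  assume last: "a (p - 1) = 0"
  \<comment> \<open>The argument in the last summand, \<open>i = p - 2\<close>. Its entry at index
    \<open>p - 1\<close> is -1 when \<open>a (p - 1) = 0\<close>, so this summand drops out.\<close>
  let ?b = "a - unit_vec 0 + unit_vec q - unit_vec (Suc q)"
  have "?b (Suc q) < 0" using last by (simp add: q unit_vec_def)
  then have "gam (Suc q) ?b = 0"
    using gam_support[of "Suc q" ?b] Lambda_D(2)[of ?b "Suc q" "Suc q"] by force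
  then show "int (gam p a) = int (gam (p - 1) (a - unit_vec 0)) +
         (\<Sum>i\<in>{0..<p - 2}. (a i + 1) *
            int (gam (p - 1) (a - unit_vec 0 + unit_vec i - unit_vec (i + 1))))"
    using rec by (simp add: q atLeast0AtMost lessThan_Suc_atMost[symmetric]
        atLeast0LessThan del: gam.simps)
next
  fix p a assume "1 \<le> p" "a (p - 1) = 1" "gam p a \<noteq> 0"
  then show "a = (\<lambda>i. (int p - 2) * unit_vec 0 i) + unit_vec (p - 1)"
    by (intro Lambda_extremal_vector gam_support)
next
  fix p :: nat assume "1 \<le> p"
  then show "gam p ((\<lambda>i. (int p - 2) * unit_vec 0 i) + unit_vec (p - 1)) = 1"
    by (rule gam_extremal_value)
qed

end
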